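(* Let $h(n)$ denote the number of maximal independent sets of the meta-hexagonal cactus $H(n)$. Then $h(1)=5$, $h(2)=19$, $h(3)=64$, $h(4)=221$, $h(5)=765$, and $h(n)=3h(n-1)+h(n-2)+2h(n-3)$ for all $n\ge 6$.
   Context: For $n\ge 1$, the meta-hexagonal cactus $H(n)$ is the graph formed by a chain of $n$ 6-cycles $B_1,\dots,B_n$, where for each $1\le i\le n-1$ the consecutive cycles $B_i$ and $B_{i+1}$ share exactly one vertex, non-consecutive cycles share no vertex, every vertex lies in at most two cycles, and for each $2\le i\le n-1$ the two shared (cut) vertices of $B_i$ are at distance two in $B_i$. An independent set is maximal if no further vertex can be added while keeping it independent. *)

theory Defs
  imports "HOL-Library.Ramsey"
begin

text \<open>
  A simple graph is given by a vertex set \<open>V\<close> and a set \<open>E\<close> of two-element subsets of \<open>V\<close>;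
  this is the representation underlying \<^const>\<open>indep\<close> from \<^theory>\<open>HOL-Library.Ramsey\<close>, where
  \<open>indep S E\<close> says that \<open>S\<close> spans no edge of \<open>E\<close>.
\<close>

definition maximal_indep :: "'a set \<Rightarrow> 'a set set \<Rightarrow> 'a set \<Rightarrow> bool" where
  "maximal_indep V E S \<longleftrightarrow>
     S \<subseteq> V \<and> indep S E \<and> (\<forall>v \<in> V - S. \<not> indep (insert v S) E)"

definition num_maximal_indep :: "'a set \<Rightarrow> 'a set set \<Rightarrow> nat" where
  "num_maximal_indep V E = card {S. maximal_indep V E S}"

definition six_cycle :: "'a set \<Rightarrow> 'a set set \<Rightarrow> bool" where
  "six_cycle V E \<longleftrightarrow>
     (\<exists>c :: nat \<Rightarrow> 'a. inj_on c {..<6} \<and> V = c ` {..<6} \<and>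
        E = (\<lambda>j. {c j, c (Suc j mod 6)}) ` {..<6})"

definition walk_betw :: "'a set set \<Rightarrow> 'a \<Rightarrow> 'a list \<Rightarrow> 'a \<Rightarrow> bool" where
  "walk_betw E u xs v \<longleftrightarrow>
     xs \<noteq> [] \<and> hd xs = u \<and> last xs = v \<and> successively (\<lambda>x y. {x, y} \<in> E) xs"

text \<open>
  The distance is meaningful only when \<open>u\<close> and \<open>v\<close> are connected, which is always the case
  for two vertices of a cycle.
\<close>

definition graph_dist :: "'a set set \<Rightarrow> 'a \<Rightarrow> 'a \<Rightarrow> nat" where
  "graph_dist E u v = (LEAST k. \<exists>xs. walk_betw E u xs v \<and> length xs = Suc k)"

text \<open>
  \<open>B i\<close> and \<open>C i\<close> are the vertex set and the edge set of the \<open>i\<close>-th cycle of the chain.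
\<close>

definition meta_hexagonal_cactus :: "nat \<Rightarrow> 'a set \<Rightarrow> 'a set set \<Rightarrow> bool" where
  "meta_hexagonal_cactus n V E \<longleftrightarrow>
     (\<exists>(B :: nat \<Rightarrow> 'a set) (C :: nat \<Rightarrow> 'a set set).
        (\<forall>i \<in> {1..n}. six_cycle (B i) (C i)) \<and>
        V = (\<Union>i \<in> {1..n}. B i) \<and>
        E = (\<Union>i \<in> {1..n}. C i) \<and>
        (\<forall>i. 1 \<le> i \<and> Suc i \<le> n \<longrightarrow> card (B i \<inter> B (Suc i)) = 1) \<and>
        (\<forall>i \<in> {1..n}. \<forall>j \<in> {1..n}. Suc i < j \<longrightarrow> B i \<inter> B j = {}) \<and>
        (\<forall>v \<in> V. card {i \<in> {1..n}. v \<in> B i} \<le> 2) \<and>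
        (\<forall>i. 2 \<le> i \<and> Suc i \<le> n \<longrightarrow>
           (\<forall>u \<in> B (i - 1) \<inter> B i. \<forall>v \<in> B i \<inter> B (Suc i). graph_dist (C i) u v = 2)))"

text \<open>
  Meta-hexagonal cacti of every length exist: take the vertices \<open>0, \<dots>, 5 n\<close>, with cut
  vertices \<open>5, 10, \<dots>, 5 (n - 1)\<close>.
\<close>

lemma graph_dist_eq_2I:
  assumes "u \<noteq> v" "{u, v} \<notin> E" "{u, w} \<in> E" "{w, v} \<in> E"
  shows "graph_dist E u v = 2"
  unfolding graph_dist_def
proof (rule Least_equality)
  have "walk_betw E u [u, w, v] v"
    using assms by (simp add: walk_betw_def)
  then show "\<exists>xs. walk_betw E u xs v \<and> length xs = Suc 2"
    by (intro exI[of _ "[u, w, v]"]) simp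
next
  fix k assume "\<exists>xs. walk_betw E u xs v \<and> length xs = Suc k"
  then obtain xs where xs: "walk_betw E u xs v" "length xs = Suc k" by blast
  show "2 \<le> k"
  proof (rule ccontr)
    assume "\<not> 2 \<le> k"
    then have "length xs = Suc 0 \<or> length xs = Suc (Suc 0)" using xs(2) by linarith
    then show False
      using xs(1) assms(1,2) by (auto simp: walk_betw_def length_Suc_conv)
  qed
qed

lemma meta_hexagonal_cactus_exists:
  "\<exists>(V :: nat set) E. meta_hexagonal_cactus n V E"
proof -
  define c :: "nat \<Rightarrow> nat \<Rightarrow> nat" where "c i j = 5 * (i - 1) + [0, 1, 5, 2, 3, 4] ! j" for i j
  define B where "B i = c i ` {..<6}" for i
  define C where "C i = (\<lambda>j. {c i j, c i (Suc j mod 6)}) ` {..<6}" for i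
  have six: "{..<6::nat} = {0, 1, 2, 3, 4, 5}" by auto
  have B: "B i = {5 * (i - 1) .. 5 * (i - 1) + 5}" for i
    unfolding B_def six c_def by (auto simp: nth_Cons')
  have C: "C i = (\<lambda>(x, y). {5 * (i - 1) + x, 5 * (i - 1) + y}) `
             {(0, 1), (1, 5), (5, 2), (2, 3), (3, 4), (4, 0)}" for i
    unfolding C_def six c_def by (simp add: nth_Cons')
  have cyc: "six_cycle (B i) (C i)" for i
    unfolding six_cycle_def
  proof (intro exI conjI)
    show "inj_on (c i) {..<6}"
      unfolding six c_def by (auto simp: inj_on_def nth_Cons')
  qed (auto simp: B_def C_def)
  have cut: "B i \<inter> B (Suc i) = {5 * i}" if "1 \<le> i" for i
    using that unfolding B by auto
  have disj: "B i \<inter> B j = {}" if "1 \<le> i" "Suc i < j" for i j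
    using that unfolding B by auto
  have two: "card {i \<in> {1..n}. v \<in> B i} \<le> 2" for v
  proof -
    have "{i \<in> {1..n}. v \<in> B i} \<subseteq> {v div 5, Suc (v div 5)}"
      unfolding B by auto
    from card_mono[OF _ this] show ?thesis
      by (simp add: card_insert_if split: if_splits)
  qed
  have dist: "graph_dist (C i) u v = 2"
    if "2 \<le> i" "u \<in> B (i - 1) \<inter> B i" "v \<in> B i \<inter> B (Suc i)" for i u v
  proof -
    have u: "u = 5 * (i - 1)" using cut[of "i - 1"] that by simp
    have v: "v = 5 * (i - 1) + 5" using cut[of i] that by simp
    show ?thesis
      by (rule graph_dist_eq_2I[where w = "5 * (i - 1) + 1"])
         (auto simp: u v C doubleton_eq_iff)
  qed
  show ?thesis
    unfolding meta_hexagonal_cactus_def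
    by (rule exI[of _ "\<Union>i\<in>{1..n}. B i"], rule exI[of _ "\<Union>i\<in>{1..n}. C i"],
        rule exI[of _ B], rule exI[of _ C])
       (use cyc cut disj two dist in \<open>auto simp del: One_nat_def\<close>)
qed

end

theory Submission
  imports Defs
begin

text \<open>
  The proof is a transfer-matrix argument. Build the cactus one hexagon at a time and, for the graph
  built so far with its port \<open>p\<close> (the vertex where the next hexagon is attached), count the
  independent sets that dominate every vertex except possibly \<open>p\<close>, split according to
  whether \<open>p\<close> is selected, dominated, or neither. Attaching a hexagon whose two cut vertices are
  at distance two transforms these three counts \<open>(i, d, u)\<close> into
  \<open>(i + 2 d + u, i + 2 d + 2 u, i)\<close>. The maximal independent sets are those counted by
  \<open>i + d\<close>, and the recurrence is the Cayley--Hamilton relation of this map.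
\<close>

definition dominated :: "'a set set \<Rightarrow> 'a set \<Rightarrow> 'a \<Rightarrow> bool" where
  "dominated E S v \<longleftrightarrow> (\<exists>w\<in>S. {v, w} \<in> E)"

definition mis_except :: "'a set \<Rightarrow> 'a set set \<Rightarrow> 'a set \<Rightarrow> 'a set set" where
  "mis_except V E P = {S. S \<subseteq> V \<and> indep S E \<and> (\<forall>v \<in> V - S - P. dominated E S v)}"

definition port_state :: "'a set set \<Rightarrow> 'a \<Rightarrow> bool \<Rightarrow> bool \<Rightarrow> 'a set set" where
  "port_state E p a b = {S. (p \<in> S \<longleftrightarrow> a) \<and> (dominated E S p \<longleftrightarrow> b)}"

definition port_counts :: "'a set \<Rightarrow> 'a set set \<Rightarrow> 'a \<Rightarrow> nat \<times> nat \<times> nat" where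
  "port_counts V E p =
     (card (mis_except V E {p} \<inter> port_state E p True False),
      card (mis_except V E {p} \<inter> port_state E p False True),
      card (mis_except V E {p} \<inter> port_state E p False False))"

lemma indep_iff_not_dominated:
  assumes "E \<subseteq> [V]\<^bsup>2\<^esup>"
  shows "indep S E \<longleftrightarrow> (\<forall>v\<in>S. \<not> dominated E S v)"
proof -
  have "v \<noteq> w" if "{v, w} \<in> E" for v w
    using that assms by (auto simp: nsets_def)
  then show ?thesis
    unfolding indep_def dominated_def by blast
qed

lemma dominated_in_vertices:
  assumes "E \<subseteq> [V]\<^bsup>2\<^esup>" "dominated E S v"
  shows "v \<in> V"
  using assms by (auto simp: nsets_def dominated_def)

lemma finite_mis_except: "finite V \<Longrightarrow> finite (mis_except V E P)"
  by (rule finite_subset[of _ "Pow V"]) (auto simp: mis_except_def)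

lemma maximal_indep_iff_dominated:
  "maximal_indep V E S \<longleftrightarrow> S \<subseteq> V \<and> indep S E \<and> (\<forall>v \<in> V - S. dominated E S v)"
proof -
  have "\<not> indep (insert v S) E \<longleftrightarrow> dominated E S v" if "indep S E" "v \<notin> S" for v
    using that unfolding indep_def dominated_def by (auto simp: insert_commute)
  then show ?thesis
    unfolding maximal_indep_def by blast
qed

lemma num_maximal_indep_port_counts:
  assumes "finite V" "E \<subseteq> [V]\<^bsup>2\<^esup>" "p \<in> V" "port_counts V E p = (i, d, u)"
  shows "num_maximal_indep V E = i + d"
proof -
  let ?M = "\<lambda>a b. mis_except V E {p} \<inter> port_state E p a b"
  have "{S. maximal_indep V E S} = ?M True False \<union> ?M False True"
    using assms(3) indep_iff_not_dominated[OF assms(2)]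
    by (auto simp: maximal_indep_iff_dominated mis_except_def port_state_def)
  moreover have "?M True False \<inter> ?M False True = {}"
    by (auto simp: port_state_def)
  ultimately show ?thesis
    using assms finite_mis_except[OF assms(1), of E "{p}"]
    by (simp add: num_maximal_indep_def port_counts_def card_Un_disjoint)
qed

lemma dominated_glue:
  assumes E: "E \<subseteq> [V]\<^bsup>2\<^esup>" and C: "C \<subseteq> [B]\<^bsup>2\<^esup>" and VB: "V \<inter> B = {p}"
    and S: "S \<subseteq> V" and T: "T \<subseteq> B" and p: "p \<in> S \<longleftrightarrow> p \<in> T"
  shows "dominated (E \<union> C) (S \<union> T) v \<longleftrightarrow> dominated E S v \<or> dominated C T v"
proof -
  have cut: "w = p" if "w \<in> V" "w \<in> B" for w
    using that VB by auto
  have "w \<in> S" if "{v, w} \<in> E" "w \<in> S \<union> T" for w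
  proof -
    have "w \<in> V" using that E by (auto simp: nsets_def)
    then show ?thesis using that cut T p by blast
  qed
  moreover have "w \<in> T" if "{v, w} \<in> C" "w \<in> S \<union> T" for w
  proof -
    have "w \<in> B" using that C by (auto simp: nsets_def)
    then show ?thesis using that cut S p by blast
  qed
  ultimately show ?thesis
    unfolding dominated_def by blast
qed

lemma nsets_glue:
  assumes "E \<subseteq> [V]\<^bsup>k\<^esup>" "C \<subseteq> [B]\<^bsup>k\<^esup>"
  shows "E \<union> C \<subseteq> [V \<union> B]\<^bsup>k\<^esup>"
  using assms by (auto simp: nsets_def)

lemma mis_glue_iff:
  assumes E: "E \<subseteq> [V]\<^bsup>2\<^esup>" and C: "C \<subseteq> [B]\<^bsup>2\<^esup>" and VB: "V \<inter> B = {p}"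
    and q: "q \<in> B" "q \<noteq> p"
    and S: "S \<subseteq> V" and T: "T \<subseteq> B" and p: "p \<in> S \<longleftrightarrow> p \<in> T"
  shows "S \<union> T \<in> mis_except (V \<union> B) (E \<union> C) {q} \<inter> port_state (E \<union> C) q a b \<longleftrightarrow>
    S \<in> mis_except V E {p} \<and> T \<in> mis_except B C {p, q} \<inter> port_state C q a b \<and>
    (p \<in> S \<or> dominated E S p \<or> dominated C T p)"
proof -
  note dom = dominated_glue[OF E C VB S T p]
  have E': "v \<in> V" if "dominated E S v" for v
    by (rule dominated_in_vertices[OF E that])
  have C': "v \<in> B" if "dominated C T v" for v
    by (rule dominated_in_vertices[OF C that])
  have cut: "w = p" if "w \<in> V" "w \<in> B" for w
    using that VB by auto
  have ind: "indep (S \<union> T) (E \<union> C) \<longleftrightarrow> indep S E \<and> indep T C"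
    unfolding indep_iff_not_dominated[OF E] indep_iff_not_dominated[OF C]
      indep_iff_not_dominated[OF nsets_glue[OF E C]] dom
    using E' C' S T p cut by blast
  have qV: "q \<notin> V" "q \<notin> S" "\<not> dominated E S q"
    using q VB E' S by auto
  have port: "S \<union> T \<in> port_state (E \<union> C) q a b \<longleftrightarrow> T \<in> port_state C q a b"
    using qV by (simp add: port_state_def dom)
  have pVB: "p \<in> V" "p \<in> B" using VB by auto
  have rest: "(\<forall>v \<in> V \<union> B - (S \<union> T) - {q}. dominated E S v \<or> dominated C T v) \<longleftrightarrow>
    (\<forall>v \<in> V - S - {p}. dominated E S v) \<and> (\<forall>v \<in> B - T - {p, q}. dominated C T v) \<and>
    (p \<in> S \<or> dominated E S p \<or> dominated C T p)" (is "?L \<longleftrightarrow> ?R")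
  proof
    assume L: ?L
    have "dominated E S v" if "v \<in> V - S - {p}" for v
    proof -
      have "v \<notin> B" using that VB by auto
      then show ?thesis using L that C' T qV by blast
    qed
    moreover have "dominated C T v" if "v \<in> B - T - {p, q}" for v
    proof -
      have "v \<notin> V" using that VB by auto
      then show ?thesis using L that E' S by blast
    qed
    moreover have "p \<in> S \<or> dominated E S p \<or> dominated C T p"
      using L pVB p q by blast
    ultimately show ?R by blast
  next
    assume ?R
    then show ?L by blast
  qed
  have sub: "S \<union> T \<subseteq> V \<union> B" using S T by blast
  show ?thesis
    unfolding Int_iff port unfolding mis_except_def mem_Collect_eq dom rest ind
    by (simp only: S T sub simp_thms conj_ac)
qed

text \<open>
  A selected port is never dominated, so the compatible pairs of states at the shared vertex are
  selected/selected, dominated/dominated, dominated/neither and neither/dominated.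
\<close>

lemma card_mis_glue:
  assumes fin: "finite V" "finite B"
    and E: "E \<subseteq> [V]\<^bsup>2\<^esup>" and C: "C \<subseteq> [B]\<^bsup>2\<^esup>" and VB: "V \<inter> B = {p}"
    and q: "q \<in> B" "q \<noteq> p" and counts: "port_counts V E p = (i, d, u)"
  defines "N \<equiv> \<lambda>s t a b. card (mis_except B C {p, q} \<inter> port_state C p s t \<inter> port_state C q a b)"
  shows "card (mis_except (V \<union> B) (E \<union> C) {q} \<inter> port_state (E \<union> C) q a b) =
    i * N True False a b + d * (N False True a b + N False False a b) + u * N False True a b"
proof -
  let ?G = "mis_except (V \<union> B) (E \<union> C) {q} \<inter> port_state (E \<union> C) q a b"
  define X where "X s t = mis_except V E {p} \<inter> port_state E p s t" for s t
  define Y where "Y s t = mis_except B C {p, q} \<inter> port_state C p s t \<inter> port_state C q a b" for s t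
  define Z where "Z = {(S, T). S \<in> mis_except V E {p} \<and>
    T \<in> mis_except B C {p, q} \<inter> port_state C q a b \<and> (p \<in> S \<longleftrightarrow> p \<in> T) \<and>
    (p \<in> S \<or> dominated E S p \<or> dominated C T p)}"
  have sub: "S \<subseteq> V" "T \<subseteq> B" if "(S, T) \<in> Z" for S T
    using that by (auto simp: Z_def mis_except_def)
  have "bij_betw (\<lambda>(S, T). S \<union> T) Z ?G"
  proof (rule bij_betw_byWitness[where f' = "\<lambda>U. (U \<inter> V, U \<inter> B)"])
    have "(S \<union> T) \<inter> V = S \<and> (S \<union> T) \<inter> B = T" if Z: "(S, T) \<in> Z" for S T
    proof -
      have "p \<in> S \<longleftrightarrow> p \<in> T" using Z by (simp add: Z_def)
      moreover have "w = p" if "w \<in> V" "w \<in> B" for w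
        using that VB by auto
      ultimately show ?thesis using sub[OF Z] by blast
    qed
    then show "\<forall>x\<in>Z. (\<lambda>U. (U \<inter> V, U \<inter> B)) ((\<lambda>(S, T). S \<union> T) x) = x" by auto
    have G: "U = (U \<inter> V) \<union> (U \<inter> B)" if "U \<in> ?G" for U
      using that by (auto simp: mis_except_def)
    then show "\<forall>U\<in>?G. (\<lambda>(S, T). S \<union> T) (U \<inter> V, U \<inter> B) = U" by auto
    show "(\<lambda>(S, T). S \<union> T) ` Z \<subseteq> ?G"
    proof (rule image_subsetI)
      fix x assume "x \<in> Z"
      then obtain S T where x: "x = (S, T)" and Z: "(S, T) \<in> Z" by (cases x) auto
      then have p: "p \<in> S \<longleftrightarrow> p \<in> T" by (simp add: Z_def)
      show "(case x of (S, T) \<Rightarrow> S \<union> T) \<in> ?G"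
        unfolding x prod.case mis_glue_iff[OF E C VB q sub[OF Z] p] using Z by (auto simp: Z_def)
    qed
    show "(\<lambda>U. (U \<inter> V, U \<inter> B)) ` ?G \<subseteq> Z"
    proof (rule image_subsetI)
      fix U assume U: "U \<in> ?G"
      have p: "p \<in> U \<inter> V \<longleftrightarrow> p \<in> U \<inter> B" using VB by auto
      have "(U \<inter> V) \<union> (U \<inter> B) \<in> ?G" using U G[OF U] by simp
      then show "(U \<inter> V, U \<inter> B) \<in> Z"
        unfolding mis_glue_iff[OF E C VB q Int_lower2 Int_lower2 p] using p
        by (simp add: Z_def)
    qed
  qed
  then have "card ?G = card Z" by (simp add: bij_betw_same_card)
  have S: "\<not> dominated E S p" if "S \<in> mis_except V E {p}" "p \<in> S" for S
    using that indep_iff_not_dominated[OF E] by (simp add: mis_except_def)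
  have T: "\<not> dominated C T p" if "T \<in> mis_except B C {p, q}" "p \<in> T" for T
    using that indep_iff_not_dominated[OF C] by (simp add: mis_except_def)
  note \<open>card ?G = card Z\<close>
  also have "Z = X True False \<times> Y True False \<union> X False True \<times> Y False True \<union>
      X False True \<times> Y False False \<union> X False False \<times> Y False True"
  proof (rule set_eqI)
    fix x :: "'a set \<times> 'a set"
    obtain S T where "x = (S, T)" by (cases x)
    then show "x \<in> Z \<longleftrightarrow> x \<in> X True False \<times> Y True False \<union> X False True \<times> Y False True \<union>
      X False True \<times> Y False False \<union> X False False \<times> Y False True"
      using S[of S] T[of T] by (simp add: Z_def X_def Y_def port_state_def) blast
  qed
  also have "card \<dots> = card (X True False) * card (Y True False) +
      card (X False True) * card (Y False True) + card (X False True) * card (Y False False) +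
      card (X False False) * card (Y False True)"
  proof -
    have fX: "finite (X s t)" and fY: "finite (Y s t)" for s t
      unfolding X_def Y_def by (intro finite_Int disjI1 finite_mis_except fin)+
    have dX: "X s t \<inter> X s' t' = {}" and dY: "Y s t \<inter> Y s' t' = {}" if "(s, t) \<noteq> (s', t')" for s t s' t'
      using that by (auto simp: X_def Y_def port_state_def)
    show ?thesis
      by (simp add: card_Un_disjoint card_cartesian_product fX fY Int_Un_distrib2
          Times_Int_Times dX dY)
  qed
  finally show ?thesis
    using counts by (simp add: port_counts_def N_def X_def Y_def algebra_simps)
qed

definition hexagon :: "'a set \<Rightarrow> 'a set set \<Rightarrow> 'a \<Rightarrow> 'a \<Rightarrow> bool" where
  "hexagon B C p q \<longleftrightarrow> (\<exists>b d e f. distinct [p, b, q, d, e, f] \<and> B = {p, b, q, d, e, f} \<and>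
     C = {{p, b}, {b, q}, {q, d}, {d, e}, {e, f}, {f, p}})"

lemma hexagon_mem: "hexagon B C p q \<Longrightarrow> p \<in> B \<and> q \<in> B \<and> q \<noteq> p"
  by (auto simp: hexagon_def)

lemma hexagon_graph: "hexagon B C p q \<Longrightarrow> finite B \<and> C \<subseteq> [B]\<^bsup>2\<^esup>"
  by (auto simp: hexagon_def nsets_def)

lemma hexagon_sym:
  assumes "hexagon B C p q" shows "hexagon B C q p"
proof -
  obtain b d e f where "distinct [p, b, q, d, e, f]" "B = {p, b, q, d, e, f}"
    "C = {{p, b}, {b, q}, {q, d}, {d, e}, {e, f}, {f, p}}"
    using assms by (auto simp: hexagon_def)
  then have "distinct [q, b, p, f, e, d]" "B = {q, b, p, f, e, d}"
    "C = {{q, b}, {b, p}, {p, f}, {f, e}, {e, d}, {d, q}}"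
    by (auto simp: insert_commute)
  then show ?thesis unfolding hexagon_def by blast
qed

lemma hexagon_card_mis:
  assumes "hexagon B C p q"
  defines "M \<equiv> \<lambda>s t a b. mis_except B C {p, q} \<inter> port_state C p s t \<inter> port_state C q a b"
  shows "card (M True False True False) = 1" "card (M True False False True) = 1"
    "card (M True False False False) = 1" "card (M False True True False) = 1"
    "card (M False True False True) = 2" "card (M False True False False) = 0"
    "card (M False False True False) = 1" "card (M False False False True) = 0"
    "card (M False False False False) = 0"
proof -
  obtain b d e f where dist: "distinct [p, b, q, d, e, f]" and B: "B = {p, b, q, d, e, f}"
    and C: "C = {{p, b}, {b, q}, {q, d}, {d, e}, {e, f}, {f, p}}"
    using assms(1) by (auto simp: hexagon_def)
  have dom: "dominated C T p \<longleftrightarrow> b \<in> T \<or> f \<in> T" "dominated C T b \<longleftrightarrow> p \<in> T \<or> q \<in> T"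
    "dominated C T q \<longleftrightarrow> b \<in> T \<or> d \<in> T" "dominated C T d \<longleftrightarrow> q \<in> T \<or> e \<in> T"
    "dominated C T e \<longleftrightarrow> d \<in> T \<or> f \<in> T" "dominated C T f \<longleftrightarrow> e \<in> T \<or> p \<in> T" for T
    using dist unfolding dominated_def C by (auto simp: doubleton_eq_iff)
  have ind: "indep T C \<longleftrightarrow> \<not> (p \<in> T \<and> b \<in> T) \<and> \<not> (b \<in> T \<and> q \<in> T) \<and> \<not> (q \<in> T \<and> d \<in> T) \<and>
    \<not> (d \<in> T \<and> e \<in> T) \<and> \<not> (e \<in> T \<and> f \<in> T) \<and> \<not> (f \<in> T \<and> p \<in> T)" if "T \<subseteq> B" for T
  proof -
    have "indep T C \<longleftrightarrow> (\<forall>v\<in>B. v \<in> T \<longrightarrow> \<not> dominated C T v)"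
      using indep_iff_not_dominated hexagon_graph[OF assms(1)] that by blast
    then show ?thesis unfolding B by (simp add: dom) blast
  qed
  have eq: "T = X \<longleftrightarrow> (\<forall>v\<in>B. v \<in> T \<longleftrightarrow> v \<in> X)" if "T \<subseteq> B" "X \<subseteq> B" for T X
    using that by blast
  have M: "T \<in> M s t a c \<longleftrightarrow> T \<subseteq> B \<and> indep T C \<and> (b \<in> T \<or> p \<in> T \<or> q \<in> T) \<and>
    (d \<in> T \<or> q \<in> T \<or> e \<in> T) \<and> (e \<in> T \<or> d \<in> T \<or> f \<in> T) \<and> (f \<in> T \<or> e \<in> T \<or> p \<in> T) \<and>
    (p \<in> T \<longleftrightarrow> s) \<and> (b \<in> T \<or> f \<in> T \<longleftrightarrow> t) \<and> (q \<in> T \<longleftrightarrow> a) \<and> (b \<in> T \<or> d \<in> T \<longleftrightarrow> c)" for T s t a c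
  proof -
    have "(\<forall>v\<in>B - T - {p, q}. dominated C T v) \<longleftrightarrow>
      (\<forall>v\<in>B. v \<in> T \<or> v = p \<or> v = q \<or> dominated C T v)" by blast
    also have "\<dots> \<longleftrightarrow> (b \<in> T \<or> p \<in> T \<or> q \<in> T) \<and>
      (d \<in> T \<or> q \<in> T \<or> e \<in> T) \<and> (e \<in> T \<or> d \<in> T \<or> f \<in> T) \<and> (f \<in> T \<or> e \<in> T \<or> p \<in> T)"
      using dist unfolding B by (auto simp: dom)
    finally have rest: "(\<forall>v\<in>B - T - {p, q}. dominated C T v) \<longleftrightarrow> (b \<in> T \<or> p \<in> T \<or> q \<in> T) \<and>
      (d \<in> T \<or> q \<in> T \<or> e \<in> T) \<and> (e \<in> T \<or> d \<in> T \<or> f \<in> T) \<and> (f \<in> T \<or> e \<in> T \<or> p \<in> T)" .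
    show ?thesis
      unfolding M_def mis_except_def port_state_def Int_iff mem_Collect_eq dom rest
      by (simp only: conj_assoc)
  qed
  have single: "M s t a c = {X}"
    if "X \<subseteq> B" "\<And>T. T \<subseteq> B \<Longrightarrow> T \<in> M s t a c \<longleftrightarrow> (\<forall>v\<in>B. v \<in> T \<longleftrightarrow> v \<in> X)" for s t a c X
  proof (rule set_eqI)
    fix T
    show "T \<in> M s t a c \<longleftrightarrow> T \<in> {X}"
    proof (cases "T \<subseteq> B")
      case True
      then show ?thesis using that(2) eq[OF _ that(1)] by simp
    next
      case False
      then show ?thesis using that(1) by (auto simp: M)
    qed
  qed
  have "M True False True False = {{p, q, e}}"
    by (rule single) (use dist in \<open>auto simp: M ind B\<close>)
  then show "card (M True False True False) = 1" by simp
  have "M True False False True = {{p, d}}"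
    by (rule single) (use dist in \<open>auto simp: M ind B\<close>)
  then show "card (M True False False True) = 1" by simp
  have "M True False False False = {{p, e}}"
    by (rule single) (use dist in \<open>auto simp: M ind B\<close>)
  then show "card (M True False False False) = 1" by simp
  have "M False True True False = {{q, f}}"
    by (rule single) (use dist in \<open>auto simp: M ind B\<close>)
  then show "card (M False True True False) = 1" by simp
  have "M False False True False = {{q, e}}"
    by (rule single) (use dist in \<open>auto simp: M ind B\<close>)
  then show "card (M False False True False) = 1" by simp
  have pair: "T \<in> M False True False True \<longleftrightarrow>
      T \<subseteq> B \<and> ((\<forall>v\<in>B. v \<in> T \<longleftrightarrow> v \<in> {b, e}) \<or> (\<forall>v\<in>B. v \<in> T \<longleftrightarrow> v \<in> {b, d, f}))" for T
    by (cases "T \<subseteq> B") (use dist in \<open>auto simp: M ind B\<close>)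
  have sub: "{b, e} \<subseteq> B" "{b, d, f} \<subseteq> B" by (auto simp: B)
  have "T \<in> M False True False True \<longleftrightarrow> T = {b, e} \<or> T = {b, d, f}" for T
  proof (cases "T \<subseteq> B")
    case True
    then show ?thesis
      unfolding pair eq[OF True sub(1)] eq[OF True sub(2)] by (simp only: simp_thms)
  next
    case False
    then have "T \<notin> M False True False True" by (simp only: pair simp_thms)
    then show ?thesis using False sub by blast
  qed
  then have "M False True False True = {{b, e}, {b, d, f}}" by blast
  moreover have "e \<notin> {b, d, f}" using dist by auto
  then have "{b, e} \<noteq> {b, d, f}" by blast
  ultimately show "card (M False True False True) = 2" by simp
  have "M False True False False = {}" "M False False False True = {}"
    "M False False False False = {}"
    by (auto simp: M)
  then show "card (M False True False False) = 0" "card (M False False False True) = 0"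
    "card (M False False False False) = 0"
    by simp_all
qed

definition transfer :: "nat \<times> nat \<times> nat \<Rightarrow> nat \<times> nat \<times> nat" where
  "transfer = (\<lambda>(i, d, u). (i + 2 * d + u, i + 2 * d + 2 * u, i))"

lemma port_counts_glue_hexagon:
  assumes "finite V" "E \<subseteq> [V]\<^bsup>2\<^esup>" "hexagon B C p q" "V \<inter> B = {p}"
  shows "port_counts (V \<union> B) (E \<union> C) q = transfer (port_counts V E p)"
proof -
  obtain i d u where idu: "port_counts V E p = (i, d, u)" by (metis prod_cases3)
  note glue = card_mis_glue[OF assms(1) conjunct1[OF hexagon_graph[OF assms(3)]] assms(2)
      conjunct2[OF hexagon_graph[OF assms(3)]] assms(4) _ _ idu]
  show ?thesis
    using hexagon_mem[OF assms(3)] unfolding idu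
    by (simp add: port_counts_def transfer_def glue hexagon_card_mis[OF assms(3)])
qed

lemma port_counts_singleton: "port_counts {p} {} p = (1, 0, 1)"
proof -
  have "mis_except {p} {} {p} \<inter> port_state {} p True False = {{p}}"
    "mis_except {p} {} {p} \<inter> port_state {} p False True = {}"
    "mis_except {p} {} {p} \<inter> port_state {} p False False = {{}}"
    by (auto simp: mis_except_def port_state_def dominated_def indep_def)
  then show ?thesis by (simp add: port_counts_def)
qed

lemma six_cycle_vertices:
  assumes "six_cycle B C" "p \<in> B"
  obtains b c d e f where "distinct [p, b, c, d, e, f]" "B = {p, b, c, d, e, f}"
    "C = {{p, b}, {b, c}, {c, d}, {d, e}, {e, f}, {f, p}}"
proof -
  define K where "K a b c d e f \<longleftrightarrow> distinct [a, b, c, d, e, f] \<and> B = {a, b, c, d, e, f} \<and>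
    C = {{a, b}, {b, c}, {c, d}, {d, e}, {e, f}, {f, a}}" for a b c d e f
  have rotate: "K b c d e f a" if "K a b c d e f" for a b c d e f
    using that unfolding K_def by (auto simp: insert_commute)
  have six: "{..<6::nat} = {0, 1, 2, 3, 4, 5}" by auto
  obtain c where inj: "inj_on c {..<6}" and B: "B = c ` {..<6}"
    and C: "C = (\<lambda>j. {c j, c (Suc j mod 6)}) ` {..<6}"
    using assms(1) by (auto simp: six_cycle_def)
  have "distinct [c 0, c 1, c 2, c 3, c 4, c 5]"
    using inj unfolding six by (auto simp: inj_on_def)
  moreover have B': "B = {c 0, c 1, c 2, c 3, c 4, c 5}"
    unfolding B six by simp
  moreover have "C = {{c 0, c 1}, {c 1, c 2}, {c 2, c 3}, {c 3, c 4}, {c 4, c 5}, {c 5, c 0}}"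
    unfolding C six by (simp flip: numeral_2_eq_2)
  ultimately have "K (c 0) (c 1) (c 2) (c 3) (c 4) (c 5)"
    by (simp add: K_def)
  moreover have "p = c 0 \<or> p = c 1 \<or> p = c 2 \<or> p = c 3 \<or> p = c 4 \<or> p = c 5"
    using assms(2) B' by blast
  ultimately have "\<exists>b c d e f. K p b c d e f"
    using rotate by metis
  then show thesis using that unfolding K_def by blast
qed

lemma six_cycle_hexagon:
  assumes "six_cycle B C" "p \<in> B"
  shows "\<exists>q. hexagon B C p q"
  using six_cycle_vertices[OF assms] unfolding hexagon_def by metis

lemma six_cycle_dist_2_hexagon:
  assumes "six_cycle B C" "p \<in> B" "q \<in> B" "graph_dist C p q = 2"
  shows "hexagon B C p q"
proof -
  obtain b c d e f where dist: "distinct [p, b, c, d, e, f]" and B: "B = {p, b, c, d, e, f}"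
    and C: "C = {{p, b}, {b, c}, {c, d}, {d, e}, {e, f}, {f, p}}"
    using six_cycle_vertices[OF assms(1,2)] .
  let ?W = "\<lambda>k. \<exists>xs. walk_betw C p xs q \<and> length xs = Suc k"
  have "walk_betw C p [p] p" "walk_betw C p [p, b] b" "walk_betw C p [p, b, c] c"
    "walk_betw C p [p, b, c, d] d" "walk_betw C p [p, b, c, d, e] e"
    "walk_betw C p [p, b, c, d, e, f] f"
    by (auto simp: walk_betw_def C)
  then obtain xs where xs: "walk_betw C p xs q"
    using assms(3) unfolding B by blast
  then have "?W (length xs - 1)"
    by (intro exI[of _ xs]) (simp add: walk_betw_def)
  then have "\<exists>k. ?W k" ..
  then have "?W (graph_dist C p q)"
    unfolding graph_dist_def by (rule LeastI_ex)
  then obtain w where w: "{p, w} \<in> C" "{w, q} \<in> C"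
    using assms(4) by (auto simp: walk_betw_def length_Suc_conv numeral_2_eq_2)
  have "q \<noteq> p"
  proof
    assume "q = p"
    then have "?W 0" by (intro exI[of _ "[p]"]) (simp add: walk_betw_def)
    then have "graph_dist C p q \<le> 0" unfolding graph_dist_def by (rule Least_le)
    then show False using assms(4) by simp
  qed
  have "w = b \<or> w = f" using w(1) dist unfolding C by (auto simp: doubleton_eq_iff)
  then have "q = c \<or> q = e"
    using w(2) dist \<open>q \<noteq> p\<close> unfolding C by (auto simp: doubleton_eq_iff)
  then show ?thesis
  proof
    assume "q = c"
    then show ?thesis using dist B C unfolding hexagon_def by blast
  next
    assume "q = e"
    then have "distinct [p, f, q, d, c, b]" "B = {p, f, q, d, c, b}"
      "C = {{p, f}, {f, q}, {q, d}, {d, c}, {c, b}, {b, p}}"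
      using dist B C by (auto simp: insert_commute)
    then show ?thesis unfolding hexagon_def by blast
  qed
qed

lemma port_counts_chain:
  assumes hex: "\<And>i. i \<in> {1..n} \<Longrightarrow> hexagon (B i) (C i) (p (i - 1)) (p i)"
    and cut: "\<And>i. 1 \<le> i \<Longrightarrow> Suc i \<le> n \<Longrightarrow> B i \<inter> B (Suc i) = {p i}"
    and disj: "\<And>i j. i \<in> {1..n} \<Longrightarrow> j \<in> {1..n} \<Longrightarrow> Suc i < j \<Longrightarrow> B i \<inter> B j = {}"
    and "k \<le> n"
  defines "W \<equiv> \<lambda>k. insert (p 0) (\<Union>i\<in>{1..k}. B i)" and "F \<equiv> \<lambda>k. \<Union>i\<in>{1..k}. C i"
  shows "finite (W k) \<and> F k \<subseteq> [W k]\<^bsup>2\<^esup> \<and> p k \<in> W k \<and>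
    port_counts (W k) (F k) (p k) = (transfer ^^ k) (1, 0, 1)"
  using \<open>k \<le> n\<close>
proof (induction k)
  case 0
  then show ?case by (simp add: W_def F_def port_counts_singleton)
next
  case (Suc k)
  have W: "W (Suc k) = W k \<union> B (Suc k)" and F: "F (Suc k) = F k \<union> C (Suc k)"
    by (auto simp: W_def F_def atLeastAtMostSuc_conv)
  have hexk: "hexagon (B (Suc k)) (C (Suc k)) (p k) (p (Suc k))"
    using hex[of "Suc k"] Suc.prems by simp
  have "W k \<inter> B (Suc k) = {p k}"
  proof (cases "k = 0")
    case True
    then show ?thesis using hexagon_mem[OF hexk] by (auto simp: W_def)
  next
    case False
    have p0: "p 0 \<in> B 1" using hexagon_mem[OF hex[of 1]] Suc.prems by simp
    have "W k = B k \<union> (\<Union>i\<in>{1..<k}. B i)"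
    proof -
      have "{1..k} = insert k {1..<k}" using False by auto
      then have "(\<Union>i\<in>{1..k}. B i) = B k \<union> (\<Union>i\<in>{1..<k}. B i)" by simp
      moreover have "p 0 \<in> (\<Union>i\<in>{1..k}. B i)" using p0 False by force
      ultimately show ?thesis unfolding W_def by blast
    qed
    moreover have "B i \<inter> B (Suc k) = {}" if "i \<in> {1..<k}" for i
      using disj[of i "Suc k"] that Suc.prems by auto
    moreover have "B k \<inter> B (Suc k) = {p k}"
      using cut[of k] False Suc.prems by simp
    ultimately show ?thesis by blast
  qed
  moreover have IH: "finite (W k)" "F k \<subseteq> [W k]\<^bsup>2\<^esup>"
    "port_counts (W k) (F k) (p k) = (transfer ^^ k) (1, 0, 1)"
    using Suc by auto
  ultimately have "port_counts (W (Suc k)) (F (Suc k)) (p (Suc k)) = (transfer ^^ Suc k) (1, 0, 1)"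
    unfolding W F using port_counts_glue_hexagon[OF IH(1,2) hexk] by simp
  moreover have "F (Suc k) \<subseteq> [W (Suc k)]\<^bsup>2\<^esup>"
    unfolding W F using nsets_glue IH(2) hexagon_graph[OF hexk] by blast
  ultimately show ?case
    using IH(1) hexagon_graph[OF hexk] hexagon_mem[OF hexk] W by simp
qed

lemma num_maximal_indep_cactus:
  assumes "meta_hexagonal_cactus n V E" "n \<ge> 1" "(transfer ^^ n) (1, 0, 1) = (i, d, u)"
  shows "num_maximal_indep V E = i + d"
proof -
  obtain B C where "\<forall>i\<in>{1..n}. six_cycle (B i) (C i)"
    and V: "V = (\<Union>i\<in>{1..n}. B i)" and E: "E = (\<Union>i\<in>{1..n}. C i)"
    and "\<forall>i. 1 \<le> i \<and> Suc i \<le> n \<longrightarrow> card (B i \<inter> B (Suc i)) = 1"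
    and "\<forall>i\<in>{1..n}. \<forall>j\<in>{1..n}. Suc i < j \<longrightarrow> B i \<inter> B j = {}"
    and "\<forall>i. 2 \<le> i \<and> Suc i \<le> n \<longrightarrow>
      (\<forall>u\<in>B (i - 1) \<inter> B i. \<forall>v\<in>B i \<inter> B (Suc i). graph_dist (C i) u v = 2)"
    using assms(1) unfolding meta_hexagonal_cactus_def by (elim exE conjE)
  then have six: "\<And>i. i \<in> {1..n} \<Longrightarrow> six_cycle (B i) (C i)"
    and cut: "\<And>i. 1 \<le> i \<Longrightarrow> Suc i \<le> n \<Longrightarrow> card (B i \<inter> B (Suc i)) = 1"
    and disj: "\<And>i j. i \<in> {1..n} \<Longrightarrow> j \<in> {1..n} \<Longrightarrow> Suc i < j \<Longrightarrow> B i \<inter> B j = {}"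
    and dist: "\<And>i u v. 2 \<le> i \<Longrightarrow> Suc i \<le> n \<Longrightarrow> u \<in> B (i - 1) \<inter> B i \<Longrightarrow>
       v \<in> B i \<inter> B (Suc i) \<Longrightarrow> graph_dist (C i) u v = 2"
    by blast+
  define x where "x i = the_elem (B i \<inter> B (Suc i))" for i
  have x: "B i \<inter> B (Suc i) = {x i}" if i: "1 \<le> i" "Suc i \<le> n" for i
  proof -
    obtain y where "B i \<inter> B (Suc i) = {y}"
      by (rule card_1_singletonE[OF cut[OF i]])
    then show ?thesis by (simp add: x_def)
  qed
  have "\<exists>p. (\<forall>i\<in>{1..n}. hexagon (B i) (C i) (p (i - 1)) (p i)) \<and>
    (\<forall>i. 1 \<le> i \<longrightarrow> Suc i \<le> n \<longrightarrow> p i = x i)"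
  proof (cases "n = 1")
    case True
    have six1: "six_cycle (B 1) (C 1)" using six True by simp
    have "B 1 \<noteq> {}" using six1 by (auto simp: six_cycle_def lessThan_empty_iff)
    then obtain p where "p \<in> B 1" by blast
    then obtain q where "hexagon (B 1) (C 1) p q"
      using six_cycle_hexagon[OF six1] by blast
    then show ?thesis using True
      by (intro exI[of _ "\<lambda>i. if i = 0 then p else q"]) auto
  next
    case False
    then have n: "2 \<le> n" using assms(2) by simp
    have "x 1 \<in> B 1" using x[of 1] n by auto
    then obtain p where p: "hexagon (B 1) (C 1) p (x 1)"
      using six_cycle_hexagon[OF six[of 1]] n hexagon_sym by fastforce
    have xpred: "x (i - 1) \<in> B (i - 1) \<inter> B i" if i: "2 \<le> i" "i \<le> n" for i
    proof -
      have "1 \<le> i - 1" "Suc (i - 1) = i" using i by auto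
      then show ?thesis using x[of "i - 1"] i by auto
    qed
    have "x (n - 1) \<in> B n" using xpred[of n] n by simp
    then obtain q where q: "hexagon (B n) (C n) (x (n - 1)) q"
      using six_cycle_hexagon[OF six[of n]] n by auto
    have mid: "hexagon (B i) (C i) (x (i - 1)) (x i)" if "2 \<le> i" "Suc i \<le> n" for i
    proof (rule six_cycle_dist_2_hexagon)
      show "six_cycle (B i) (C i)" using six that by simp
      have u: "x (i - 1) \<in> B (i - 1) \<inter> B i" using xpred[of i] that by simp
      have v: "x i \<in> B i \<inter> B (Suc i)" using x[of i] that by auto
      show "x (i - 1) \<in> B i" "x i \<in> B i" using u v by auto
      show "graph_dist (C i) (x (i - 1)) (x i) = 2" using dist that u v by blast
    qed
    let ?p = "\<lambda>i. if i = 0 then p else if i = n then q else x i"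
    have "hexagon (B i) (C i) (?p (i - 1)) (?p i)" if "i \<in> {1..n}" for i
    proof -
      consider "i = 1" | "i = n" "i \<noteq> 1" | "2 \<le> i" "Suc i \<le> n" using \<open>i \<in> {1..n}\<close> by force
      then show ?thesis
        using p q mid n by cases auto
    qed
    then show ?thesis by (intro exI[of _ ?p]) auto
  qed
  then obtain p where hex: "\<And>i. i \<in> {1..n} \<Longrightarrow> hexagon (B i) (C i) (p (i - 1)) (p i)"
    and px: "\<And>i. 1 \<le> i \<Longrightarrow> Suc i \<le> n \<Longrightarrow> p i = x i" by blast
  have "p 0 \<in> B 1" using hexagon_mem[OF hex[of 1]] assms(2) by simp
  then have "insert (p 0) V = V" using assms(2) unfolding V by force
  moreover have "B i \<inter> B (Suc i) = {p i}" if "1 \<le> i" "Suc i \<le> n" for i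
    using x px that by simp
  note port_counts_chain[where B = B and C = C and p = p and k = n, OF hex this disj order_refl,
      folded V E]
  ultimately show ?thesis
    using num_maximal_indep_port_counts[of V E "p n" i d u] assms(3) by simp
qed

theorem theorem2p16:
  fixes V :: "nat \<Rightarrow> 'a set" and E :: "nat \<Rightarrow> 'a set set" and h :: "nat \<Rightarrow> nat"
  assumes "\<And>n. n \<ge> 1 \<Longrightarrow> meta_hexagonal_cactus n (V n) (E n)"
    and "\<And>n. n \<ge> 1 \<Longrightarrow> h n = num_maximal_indep (V n) (E n)"
  shows "h 1 = 5 \<and> h 2 = 19 \<and> h 3 = 64 \<and> h 4 = 221 \<and> h 5 = 765 \<and>
    (\<forall>n \<ge> 6. h n = 3 * h (n - 1) + h (n - 2) + 2 * h (n - 3))"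
proof -
  have h: "h n = i + d" if "n \<ge> 1" "(transfer ^^ n) (1, 0, 1) = (i, d, u)" for n i d u
    using assms that num_maximal_indep_cactus by metis
  have step: "(transfer ^^ Suc k) z = (i + 2 * d + u, i + 2 * d + 2 * u, i)"
    if "(transfer ^^ k) z = (i, d, u)" for k z i d u
    using that by (simp add: transfer_def)
  have "h n = 3 * h (n - 1) + h (n - 2) + 2 * h (n - 3)" if "n \<ge> 6" for n
  proof -
    define m where "m = n - 3"
    have n: "n = Suc (Suc (Suc m))" "m \<ge> 1" using that by (auto simp: m_def)
    obtain i d u where m: "(transfer ^^ m) (1, 0, 1) = (i, d, u)" by (metis prod_cases3)
    note t1 = step[OF m] and t2 = step[OF step[OF m]] and t3 = step[OF step[OF step[OF m]]]
    show ?thesis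
      using h[OF _ m] h[OF _ t1] h[OF _ t2] h[OF _ t3] n by simp
  qed
  moreover have "h 1 = 5" "h 2 = 19" "h 3 = 64" "h 4 = 221" "h 5 = 765"
    by (subst h, simp, simp add: transfer_def numeral_eq_Suc, simp)+
  ultimately show ?thesis by blast
qed

end
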